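(* Let $p$ be an odd prime, $r$ a positive integer, $j$ an integer with $0\le j\le p-1$, and $n$ a nonnegative integer. Then \[\mathcal{E}_{pn}^{(p,j)} + \mathcal{E}_{pn+p^r}^{(p,j)} \equiv 0 \pmod{p^{r+\delta(j)}},\qquad \delta(j)=\begin{cases}1 & (j=0),\\ 0 & (0<j<p),\end{cases}\] the congruence being understood in the ring $\mathbb{Z}_p$ of $p$-adic integers (the numbers $\mathcal{E}_{pn}^{(p,j)}$ are rational numbers whose denominators are prime to $p$).
   Context: For integers $N\ge 1$ and $j\ge 0$, the congruential Euler numbers $\mathcal{E}_n^{(N,j)}\in\mathbb{Q}$ ($n\ge 0$) are defined by the identity of formal power series \[\sum_{n=0}^\infty \mathcal{E}_n^{(N,j)}\frac{z^n}{n!}=\left(\sum_{n=0}^\infty \frac{z^{Nn}}{(Nn+j)!}\right)^{-1}.\] *)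

theory Defs
  imports "HOL-Computational_Algebra.Computational_Algebra"
begin

(* The formal power series with terms z^(N n) / (N n + j)!, n = 0, 1, 2, ..., given by its
   coefficients: only the exponents m = N n occur. Meant for N >= 1. *)
definition congr_euler_denom :: "nat \<Rightarrow> nat \<Rightarrow> rat fps" where
  "congr_euler_denom N j = Abs_fps (\<lambda>m. if N dvd m then 1 / fact (m + j) else 0)"

lemma congr_euler_denom_sums:
  assumes "N \<ge> 1"
  shows "(\<lambda>n. fps_const (1 / fact (N * n + j)) * fps_X ^ (N * n)) sums congr_euler_denom N j"
proof -
  let ?f = "\<lambda>n. fps_const (1 / fact (N * n + j) :: rat) * fps_X ^ (N * n)"
  have nth: "fps_nth (\<Sum>n<K. ?f n) m = fps_nth (congr_euler_denom N j) m" if "K > m" for K m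
  proof -
    have "fps_nth (\<Sum>n<K. ?f n) m =
        (\<Sum>n<K. if m = N * n then 1 / fact (N * n + j) else 0)"
      by (auto simp: fps_sum_nth intro!: sum.cong)
    also have "\<dots> = fps_nth (congr_euler_denom N j) m"
    proof (cases "N dvd m")
      case True
      then obtain d where d: "m = N * d" by blast
      have dK: "d < K" using that d assms
        by (metis le_less_trans mult_le_mono1 nat_mult_1)
      have "(\<Sum>n<K. if m = N * n then 1 / fact (N * n + j) else 0 :: rat) =
          (\<Sum>n<K. if n = d then 1 / fact (N * d + j) else 0)"
        using d assms by (intro sum.cong) auto
      then show ?thesis using dK d by (simp add: congr_euler_denom_def)
    next
      case False
      then have "(\<Sum>n<K. if m = N * n then 1 / fact (N * n + j) else 0 :: rat) = 0"
        by (intro sum.neutral) auto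
      then show ?thesis using False by (simp add: congr_euler_denom_def)
    qed
    finally show ?thesis .
  qed
  show ?thesis
    unfolding sums_def tendsto_fps_iff
    using nth by (auto intro: eventually_mono[OF eventually_gt_at_top])
qed

definition congr_euler :: "nat \<Rightarrow> nat \<Rightarrow> nat \<Rightarrow> rat" where
  "congr_euler N j n = fact n * fps_nth (inverse (congr_euler_denom N j)) n"

lemma congr_euler_egf:
  "Abs_fps (\<lambda>n. congr_euler N j n / fact n) = inverse (congr_euler_denom N j)"
  by (rule fps_ext) (simp add: congr_euler_def)

lemma congr_euler_egf_mult:
  "Abs_fps (\<lambda>n. congr_euler N j n / fact n) * congr_euler_denom N j = 1"
  unfolding congr_euler_egf by (rule inverse_mult_eq_1) (simp add: congr_euler_denom_def)

(* For a prime p, a rational number lies in the ring of p-adic integers iff its reduced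
   denominator is prime to p. *)
definition p_integral :: "nat \<Rightarrow> rat \<Rightarrow> bool" where
  "p_integral p x \<longleftrightarrow> coprime (snd (quotient_of x)) (int p)"

(* Congruence modulo p^k of rational numbers that are p-adic integers. The cofactor z, being
   the quotient of a rational number by p^k, is automatically rational. *)
definition p_cong :: "nat \<Rightarrow> nat \<Rightarrow> rat \<Rightarrow> rat \<Rightarrow> bool" where
  "p_cong p k x y \<longleftrightarrow>
     p_integral p x \<and> p_integral p y \<and> (\<exists>z. p_integral p z \<and> x - y = of_nat p ^ k * z)"

end

theory Submission
  imports Defs "HOL-Number_Theory.Cong"
begin

text \<open>
  Write \<open>e k\<close> for the congruential Euler number of index \<open>p k\<close> and \<open>q = p^t\<close>. The defining
  identity gives \<open>\<Sum>\<^sub>k C(p n + j, p k) e k = 0\<close> for \<open>n > 0\<close>. By Vandermonde's identity,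
  \<open>C(p n + j + p q, p k) \<equiv> \<Sum>\<^sub>i C(p n + j, p i) C(q, k - i)\<close> modulo \<open>p^(t + 1 + \<delta>)\<close>: the terms
  of the convolution with \<open>p\<close> not dividing the index vanish, and \<open>C(p q, p k) \<equiv> C(q, k)\<close>. Inserting
  this in the recurrence at \<open>n + q\<close> and using that \<open>C(p n + j, p n)\<close> is prime to \<open>p\<close>, induction
  on \<open>i\<close> gives \<open>\<Sum>\<^sub>l C(q, l) e (i + l) \<equiv> 0\<close>. By induction on \<open>t\<close> one may replace \<open>e (i + l)\<close> by
  \<open>(-1)^l e i\<close> in the terms with \<open>0 < l < q\<close>, and what remains is \<open>e i + e (i + q) \<equiv> 0\<close>.
\<close>

section \<open>Divisibility by powers of \<open>p\<close> among rational numbers\<close>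

text \<open>The reduced denominator divides every other denominator of \<open>x\<close>, so any
  representation with denominator prime to \<open>p\<close> serves. Closure under sums and products
  then needs no reduction of fractions.\<close>

lemma p_integral_iff:
  assumes "prime p"
  shows "p_integral p x \<longleftrightarrow>
    (\<exists>a b. x = of_int a / of_int b \<and> coprime b (int p) \<and> b \<noteq> 0)"
proof
  assume *: "p_integral p x"
  obtain a b where ab: "quotient_of x = (a, b)" by force
  with * show "\<exists>a b. x = of_int a / of_int b \<and> coprime b (int p) \<and> b \<noteq> 0"
    using quotient_of_div[OF ab] quotient_of_denom_pos[OF ab]
    by (intro exI[of _ a] exI[of _ b]) (auto simp: p_integral_def)
next
  assume "\<exists>a b. x = of_int a / of_int b \<and> coprime b (int p) \<and> b \<noteq> 0"
  then obtain a b where *: "x = of_int a / of_int b" "coprime b (int p)" "b \<noteq> 0" by blast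
  obtain c d where cd: "quotient_of x = (c, d)" by force
  have "x = of_int c / of_int d" "d > 0" "coprime c d"
    using quotient_of_div[OF cd] quotient_of_denom_pos[OF cd] quotient_of_coprime[OF cd] by auto
  then have "(of_int (a * d) :: rat) = of_int (c * b)"
    using * by (simp add: field_simps)
  then have "a * d = c * b" by (simp only: of_int_eq_iff)
  then have "d dvd c * b" by (metis dvd_triv_right)
  with \<open>coprime c d\<close> have "d dvd b"
    by (simp add: coprime_commute coprime_dvd_mult_right_iff)
  with *(2) show "p_integral p x"
    using cd coprime_divisors[of d b "int p" "int p"] by (simp add: p_integral_def)
qed

text \<open>This says that the \<open>p\<close>-adic valuation of \<open>x\<close> is at least
  \<open>k\<close>. It isolates the divisibility part of \<open>p_cong\<close>, applied to a
  difference.\<close>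

definition p_dvd :: "nat \<Rightarrow> nat \<Rightarrow> rat \<Rightarrow> bool" where
  "p_dvd p k x \<longleftrightarrow> (\<exists>z. p_integral p z \<and> x = of_nat p ^ k * z)"

lemma p_dvd_0_iff: "p_dvd p 0 x \<longleftrightarrow> p_integral p x"
  by (simp add: p_dvd_def)

context
  fixes p :: nat
  assumes p: "prime p"
begin

lemma p_integral_of_int [simp]: "p_integral p (of_int a)"
  unfolding p_integral_iff[OF p] by (rule exI[of _ a], rule exI[of _ 1]) simp

lemma p_integral_add:
  assumes "p_integral p x" "p_integral p y"
  shows "p_integral p (x + y)"
proof -
  obtain a b c d where *: "x = of_int a / of_int b" "coprime b (int p)" "b \<noteq> 0"
      "y = of_int c / of_int d" "coprime d (int p)" "d \<noteq> 0"
    using assms unfolding p_integral_iff[OF p] by blast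
  show ?thesis unfolding p_integral_iff[OF p]
    by (rule exI[of _ "a * d + c * b"], rule exI[of _ "b * d"])
      (use * in \<open>auto simp: field_simps\<close>)
qed

lemma p_integral_mult:
  assumes "p_integral p x" "p_integral p y"
  shows "p_integral p (x * y)"
proof -
  obtain a b c d where *: "x = of_int a / of_int b" "coprime b (int p)" "b \<noteq> 0"
      "y = of_int c / of_int d" "coprime d (int p)" "d \<noteq> 0"
    using assms unfolding p_integral_iff[OF p] by blast
  show ?thesis unfolding p_integral_iff[OF p]
    by (rule exI[of _ "a * c"], rule exI[of _ "b * d"]) (use * in auto)
qed

lemma p_dvd_zero [simp]: "p_dvd p k 0"
  using p_integral_of_int[of 0] by (auto simp: p_dvd_def intro!: exI[of _ 0])

lemma p_dvd_add: "p_dvd p k x \<Longrightarrow> p_dvd p k y \<Longrightarrow> p_dvd p k (x + y)"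
  unfolding p_dvd_def by (metis distrib_left p_integral_add)

lemma p_dvd_mult: "p_dvd p k x \<Longrightarrow> p_dvd p l y \<Longrightarrow> p_dvd p (k + l) (x * y)"
  unfolding p_dvd_def
  by (elim exE conjE, rule exI, rule conjI, rule p_integral_mult, assumption, assumption)
    (simp add: power_add mult_ac)

lemma p_dvd_of_int:
  assumes "int p ^ k dvd a"
  shows "p_dvd p k (of_int a)"
  using assms unfolding p_dvd_def by (auto elim!: dvdE intro: p_integral_of_int)

lemma p_dvd_of_nat: "p ^ k dvd a \<Longrightarrow> p_dvd p k (of_nat a)"
  using p_dvd_of_int[of k "int a"] by (simp flip: of_nat_power)

lemma p_dvd_mult_left: "p_integral p x \<Longrightarrow> p_dvd p k y \<Longrightarrow> p_dvd p k (x * y)"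
  using p_dvd_mult[of 0 x k y] by (simp add: p_dvd_0_iff)

lemma p_dvd_uminus: "p_dvd p k x \<Longrightarrow> p_dvd p k (- x)"
  using p_dvd_mult_left[of "of_int (-1)" k x] p_integral_of_int[of "-1"] by simp

lemma p_dvd_diff: "p_dvd p k x \<Longrightarrow> p_dvd p k y \<Longrightarrow> p_dvd p k (x - y)"
  using p_dvd_add[of k x "- y"] p_dvd_uminus[of k y] by simp

lemma p_dvd_of_nat_mult_left: "p_dvd p k x \<Longrightarrow> p_dvd p k (of_nat m * x)"
  using p_dvd_mult_left[of "of_int (int m)" k x] p_integral_of_int[of "int m"] by simp

lemma p_dvd_sum: "(\<And>i. i \<in> A \<Longrightarrow> p_dvd p k (f i)) \<Longrightarrow> p_dvd p k (sum f A)"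
  by (induction A rule: infinite_finite_induct) (auto intro: p_dvd_add)

lemma p_dvd_mult_cancel_left:
  assumes "p_dvd p k (of_nat u * x)" "\<not> p dvd u"
  shows "p_dvd p k x"
proof -
  obtain z where z: "p_integral p z" "of_nat u * x = of_nat p ^ k * z"
    using assms(1) by (auto simp: p_dvd_def)
  have "u > 0" using assms(2) by (cases u) auto
  have "coprime (int u) (int p)"
    using prime_imp_coprime[OF p assms(2)] by (simp add: coprime_commute)
  then have "p_integral p (of_int 1 / of_int (int u))"
    unfolding p_integral_iff[OF p] using \<open>u > 0\<close> by (intro exI[of _ 1] exI[of _ "int u"]) auto
  then have "p_integral p (1 / of_nat u * z)"
    using z(1) by (intro p_integral_mult) auto
  moreover have "x = of_nat p ^ k * (1 / of_nat u * z)"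
    using z(2) \<open>u > 0\<close> by (simp add: field_simps)
  ultimately show ?thesis unfolding p_dvd_def by blast
qed

end

section \<open>Binomial coefficients modulo powers of \<open>p\<close>\<close>

lemma dvd_mult_binomial: "a dvd k * (a choose k)" if "k > 0" for a k :: nat
  using that times_binomial_minus1_eq[of k a] by simp

context
  fixes p :: nat
  assumes p: "prime p"
begin

text \<open>For \<open>l = p^s * u\<close>, the number \<open>p^t\<close> divides
  \<open>l * (p^t choose l)\<close>; cancel \<open>p^s\<close>, then the factor \<open>u\<close>,
  which is prime to \<open>p\<close>.\<close>

lemma power_dvd_binomial:
  assumes "\<not> p dvd u" "s \<le> t"
  shows "p ^ (t - s) dvd (p ^ t choose (p ^ s * u))"
proof -
  have "u > 0" using assms(1) by (cases u) auto
  then have "p ^ t dvd p ^ s * u * (p ^ t choose (p ^ s * u))"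
    using p by (intro dvd_mult_binomial) (auto simp: prime_gt_0_nat)
  moreover have "p ^ t = p ^ s * p ^ (t - s)"
    using assms(2) by (simp flip: power_add)
  ultimately have "p ^ (t - s) dvd u * (p ^ t choose (p ^ s * u))"
    using p by (simp add: mult.assoc prime_gt_0_nat)
  moreover have "coprime (p ^ (t - s)) u"
    using prime_imp_coprime[OF p assms(1)] by simp
  ultimately show ?thesis by (simp add: coprime_dvd_mult_right_iff)
qed

text \<open>This is the source of the extra factor \<open>p\<close> when
  \<open>j = 0\<close>.\<close>

lemma prime_dvd_binomial_mult:
  assumes "\<not> p dvd i"
  shows "p dvd ((p * n) choose i)"
proof -
  have "i > 0" using assms by (cases i) auto
  then have "p dvd i * ((p * n) choose i)"
    using dvd_mult_binomial[of i "p * n"] by (meson dvd_mult_left)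
  then show ?thesis using p assms by (simp add: prime_dvd_mult_iff)
qed

text \<open>Raising \<open>j\<close> by one multiplies the coefficient by
  \<open>p * n + Suc j\<close> and divides it by \<open>Suc j\<close>; the former is prime to
  \<open>p\<close> as long as \<open>Suc j < p\<close>.\<close>

lemma not_prime_dvd_binomial:
  assumes "j < p"
  shows "\<not> p dvd ((p * n + j) choose (p * n))"
  using assms
proof (induction j)
  case 0
  then show ?case using prime_gt_1_nat[OF p] by simp
next
  case (Suc j)
  have "((p * n + Suc j) choose (p * n)) * Suc j = (p * n + Suc j) * ((p * n + j) choose (p * n))"
    using binomial_absorb_comp[of "p * n + Suc j" "p * n"] by (simp add: mult.commute)
  moreover have "\<not> p dvd p * n + Suc j"
    using Suc.prems by (metis dvd_add_right_iff dvd_triv_left nat_dvd_not_less zero_less_Suc)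
  ultimately show ?case
    using Suc p by (metis Suc_lessD dvd_mult2 prime_dvd_mult_iff)
qed

text \<open>The multiples of \<open>p\<close> up to \<open>p * b\<close> contribute
  \<open>p ^ b * fact b\<close>; the double product collects the blocks between consecutive
  multiples.\<close>

lemma fact_prime_mult:
  "fact (p * b) = p ^ b * fact b * (\<Prod>c<b. \<Prod>i=1..<p. p * c + i)"
proof (induction b)
  case (Suc b)
  have *: "{1..p} = insert p {1..<p}" using prime_gt_0_nat[OF p] by auto
  have "fact (p * b + m) = fact (p * b) * (\<Prod>i=1..m. p * b + i)" for m
    by (induction m) (simp_all add: algebra_simps)
  from this[of p] have "fact (p * Suc b) = fact (p * b) * (\<Prod>i=1..p. p * b + i)"
    by (simp add: add.commute)
  also have "(\<Prod>i=1..p. p * b + i) = p * Suc b * (\<Prod>i=1..<p. p * b + i)"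
    unfolding * by simp
  finally show ?case
    unfolding Suc.IH by (simp only: prod.lessThan_Suc power_Suc fact_Suc of_nat_id mult_ac)
qed simp

text \<open>With \<open>P b\<close> the part of \<open>fact (p * b)\<close> left after removing the
  multiples of \<open>p\<close>, the quotient of the two binomials is
  \<open>P a / (P k * P (a - k))\<close> for \<open>a = p ^ t\<close>. This is 1 modulo
  \<open>p ^ (t + 1)\<close>, and for \<open>0 < k < a\<close> the coefficient
  \<open>a choose k\<close> supplies one more \<open>p\<close>.\<close>

lemma binomial_prime_mult_cong:
  assumes "odd p"
  shows "[(p * p ^ t) choose (p * k) = p ^ t choose k] (mod p ^ (t + 2))"
proof (cases "0 < k \<and> k < p ^ t")
  case False
  then consider "k = 0" | "k = p ^ t" | "k > p ^ t" by linarith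
  then show ?thesis
    using prime_gt_0_nat[OF p] by cases (auto simp: binomial_eq_0)
next
  case True
  define a where "a = p ^ t"
  define F :: "nat \<Rightarrow> nat" where "F c = (\<Prod>i=1..<p. p * c + i)" for c
  define P where "P b = (\<Prod>c<b. F c)" for b
  have ka: "k < a" "k > 0" using True by (auto simp: a_def)
  have fact_P: "fact (p * b) = p ^ b * fact b * P b" for b
    by (simp add: fact_prime_mult P_def F_def)
  have pa: "p ^ a = p ^ k * p ^ (a - k)" using ka by (simp flip: power_add)
  have "(p ^ a * (fact k * fact (a - k))) * (P k * P (a - k) * ((p * a) choose (p * k)))
      = fact (p * k) * fact (p * (a - k)) * ((p * a) choose (p * k))"
    unfolding pa fact_P by (simp only: mult_ac)
  also have "\<dots> = fact (p * a)"
    using ka binomial_fact_lemma[of "p * k" "p * a"] by (simp add: diff_mult_distrib2)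
  also have "\<dots> = p ^ a * (fact k * fact (a - k) * (a choose k)) * P a"
    using ka by (simp only: fact_P binomial_fact_lemma less_imp_le)
  also have "\<dots> = (p ^ a * (fact k * fact (a - k))) * (P a * (a choose k))"
    by (simp only: mult_ac)
  finally have eq: "P k * P (a - k) * ((p * a) choose (p * k)) = P a * (a choose k)"
    using prime_gt_0_nat[OF p] by (subst (asm) mult_cancel_left) simp
  \<comment> \<open>The reflection \<open>x \<mapsto> p a - x\<close> changes the sign of an even number of factors.\<close>
  have F_cong: "[F (a - Suc c) = F c] (mod p * a)" if c: "c < a" for c
  proof -
    have "int (F (a - Suc c)) = (\<Prod>i=1..<p. int (p * (a - Suc c) + i))"
      by (simp add: F_def)
    \<comment> \<open>Reversing the block exhibits each factor as \<open>p * a\<close> minus a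
      factor of \<open>F c\<close>.\<close>
    also have "\<dots> = (\<Prod>i=1..<p. int (p * (a - Suc c) + (p - i)))"
      by (rule prod.reindex_bij_witness[of _ "\<lambda>i. p - i" "\<lambda>i. p - i"]) auto
    also have "\<dots> = (\<Prod>i=1..<p. int (p * a) - int (p * c + i))"
    proof (rule prod.cong)
      fix i assume i: "i \<in> {1..<p}"
      obtain m where "a = Suc c + m" using c less_iff_Suc_add[of c a] by auto
      with i show "int (p * (a - Suc c) + (p - i)) = int (p * a) - int (p * c + i)"
        by (simp add: of_nat_diff algebra_simps)
    qed simp
    also have "[\<dots> = (\<Prod>i=1..<p. - int (p * c + i))] (mod int (p * a))"
      by (rule cong_prod) (simp add: cong_iff_dvd_diff)
    also have "(\<Prod>i=1..<p. - int (p * c + i)) = (-1) ^ (p - 1) * int (F c)"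
      by (subst prod_uminus) (simp_all add: F_def)
    also have "\<dots> = int (F c)" using assms by simp
    finally show ?thesis by (simp only: cong_int_iff)
  qed
  have "P a = (\<Prod>c<k. F c) * (\<Prod>c\<in>{k..<a}. F c)"
    unfolding P_def lessThan_atLeast0 using ka by (simp add: prod.atLeastLessThan_concat)
  also have "(\<Prod>c\<in>{k..<a}. F c) = (\<Prod>c<a-k. F (a - Suc c))"
    by (rule prod.reindex_bij_witness[of _ "\<lambda>c. a - Suc c" "\<lambda>c. a - Suc c"]) (use ka in auto)
  also have "[(\<Prod>c<k. F c) * (\<Prod>c<a-k. F (a - Suc c)) = P k * P (a - k)] (mod p * a)"
    unfolding P_def by (intro cong_mult cong_prod cong_refl F_cong) auto
  finally have P_cong: "[P a = P k * P (a - k)] (mod p ^ Suc t)"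
    by (simp add: a_def)
  obtain s u where su: "k = p ^ s * u" "\<not> p dvd u"
    using prime_power_canonical[OF p ka(2)] by (metis mult.commute)
  have "s < t"
  proof (rule ccontr)
    assume "\<not> s < t"
    then have "p ^ t dvd k" unfolding su by (intro dvd_mult2 le_imp_power_dvd) simp
    then show False using ka nat_dvd_not_less[of k "p ^ t"] by (simp add: a_def)
  qed
  then have "p ^ (t - s) dvd a choose k"
    unfolding a_def su(1) using su(2) by (intro power_dvd_binomial) auto
  then have "p dvd a choose k"
    using \<open>s < t\<close> by (meson dvd_power dvd_trans zero_less_diff)
  then have "int (p ^ Suc t) * int p dvd (int (P a) - int (P k * P (a - k))) * int (a choose k)"
    using P_cong by (intro mult_dvd_mono)
      (simp_all add: cong_iff_dvd_diff flip: cong_int_iff)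
  also have "(int (P a) - int (P k * P (a - k))) * int (a choose k)
      = int (P k * P (a - k)) * (int ((p * a) choose (p * k)) - int (a choose k))"
    using arg_cong[OF eq, of int] by (simp add: algebra_simps)
  finally have "int (p ^ (t + 2)) dvd
      int (P k * P (a - k)) * (int ((p * a) choose (p * k)) - int (a choose k))"
    by (simp add: mult_ac)
  \<comment> \<open>The products \<open>P\<close> may be cancelled, since none of their factors is
    divisible by \<open>p\<close>.\<close>
  moreover have "coprime (int (p ^ (t + 2))) (int (P k * P (a - k)))"
  proof -
    have "\<not> p dvd p * c + i" if "i \<in> {1..<p}" for c i
      using that by (auto dest: nat_dvd_not_less simp: dvd_add_right_iff)
    then have "coprime p (P b)" for b
      unfolding P_def F_def by (intro prod_coprime_right prime_imp_coprime[OF p]) auto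
    then show ?thesis by (simp only: coprime_int_iff) simp
  qed
  ultimately show ?thesis
    unfolding a_def by (simp only: coprime_dvd_mult_right_iff cong_iff_dvd_diff flip: cong_int_iff)
qed

lemma sum_multiples: "(\<Sum>i | i \<le> p * k \<and> p dvd i. f i) = (\<Sum>i\<le>k. f (p * i))"
  for f :: "nat \<Rightarrow> 'b :: comm_monoid_add"
  by (rule sum.reindex_bij_witness[of _ "\<lambda>i. p * i" "\<lambda>i. i div p"])
    (use p in \<open>auto simp: prime_gt_0_nat\<close>)

text \<open>In the Vandermonde sum, an index \<open>i\<close> prime to \<open>p\<close> gives
  \<open>p ^ Suc t\<close> from the second factor and, if \<open>j = 0\<close>, another
  \<open>p\<close> from the first. For the other indices the available modulus
  \<open>p ^ (t + 2)\<close> suffices because \<open>d\<close> is at most 1.\<close>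

lemma binomial_add_prime_power_cong:
  assumes "odd p" "d = (if j = 0 then 1 else 0)"
  shows "[(p * n + j + p ^ Suc t) choose (p * k)
    = (\<Sum>i\<le>k. ((p * n + j) choose (p * i)) * (p ^ t choose (k - i)))] (mod p ^ (Suc t + d))"
proof -
  let ?f = "\<lambda>i. ((p * n + j) choose i) * (p ^ Suc t choose (p * k - i))"
  have "(p * n + j + p ^ Suc t) choose (p * k) = (\<Sum>i\<le>p * k. ?f i)"
    by (simp add: vandermonde)
  also have "{..p * k} = {i. i \<le> p * k \<and> p dvd i} \<union> {i. i \<le> p * k \<and> \<not> p dvd i}" by auto
  also have "sum ?f \<dots> = sum ?f {i. i \<le> p * k \<and> p dvd i} + sum ?f {i. i \<le> p * k \<and> \<not> p dvd i}"
    by (rule sum.union_disjoint) auto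
  also have "sum ?f {i. i \<le> p * k \<and> p dvd i} = (\<Sum>i\<le>k. ?f (p * i))"
    by (rule sum_multiples)
  finally have eq: "(p * n + j + p ^ Suc t) choose (p * k) =
      (\<Sum>i\<le>k. ?f (p * i)) + sum ?f {i. i \<le> p * k \<and> \<not> p dvd i}" .
  \<comment> \<open>The sum of zeros gives both sides the same shape, so the congruence can be
    checked term by term.\<close>
  have "[(\<Sum>i\<le>k. ?f (p * i)) + sum ?f {i. i \<le> p * k \<and> \<not> p dvd i} =
     (\<Sum>i\<le>k. ((p * n + j) choose (p * i)) * (p ^ t choose (k - i)))
       + (\<Sum>i | i \<le> p * k \<and> \<not> p dvd i. 0)] (mod p ^ (Suc t + d))"
  proof (intro cong_add cong_sum cong_mult cong_refl)
    fix i assume "i \<in> {..k}"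
    have "[(p * p ^ t) choose (p * (k - i)) = p ^ t choose (k - i)] (mod p ^ (t + 2))"
      by (rule binomial_prime_mult_cong) fact
    then have "[(p * p ^ t) choose (p * (k - i)) = p ^ t choose (k - i)] (mod p ^ (Suc t + d))"
      by (rule cong_dvd_modulus_nat) (use assms(2) in \<open>auto intro!: le_imp_power_dvd\<close>)
    then show "[p ^ Suc t choose (p * k - p * i) = p ^ t choose (k - i)] (mod p ^ (Suc t + d))"
      by (simp add: diff_mult_distrib2)
  next
    fix i assume i: "i \<in> {i. i \<le> p * k \<and> \<not> p dvd i}"
    then have "\<not> p dvd p * k - i"
      by (metis diff_diff_cancel dvd_diff_nat dvd_triv_left mem_Collect_eq)
    from power_dvd_binomial[OF this, of 0 "Suc t"]
    have "p ^ Suc t dvd p ^ Suc t choose (p * k - i)" by simp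
    moreover have "p ^ d dvd (p * n + j) choose i"
      using assms(2) i prime_dvd_binomial_mult by auto
    ultimately have "p ^ d * p ^ Suc t dvd ?f i" by (rule mult_dvd_mono[rotated])
    then show "[?f i = 0] (mod p ^ (Suc t + d))"
      by (simp add: cong_0_iff power_add mult_ac)
  qed
  then show ?thesis unfolding eq by (simp only: sum.neutral_const add_0_right)
qed

section \<open>Congruences for the Euler numbers\<close>

text \<open>Compare coefficients of \<open>z^(p n)\<close> in the defining identity and multiply by
  \<open>fact (p * n + j)\<close>.\<close>

lemma congr_euler_recurrence:
  assumes "n > 0"
  shows "(\<Sum>k\<le>n. of_nat ((p * n + j) choose (p * k)) * congr_euler p j (p * k)) = 0"
proof -
  let ?H = "inverse (congr_euler_denom p j)"
  have "?H * congr_euler_denom p j = 1"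
    by (rule inverse_mult_eq_1) (simp add: congr_euler_denom_def)
  then have "(\<Sum>i\<le>p * n. fps_nth ?H i * fps_nth (congr_euler_denom p j) (p * n - i)) = 0"
    using assms p by (simp add: fps_eq_iff fps_mult_nth atLeast0AtMost)
  moreover have "(\<Sum>i\<le>p * n. fps_nth ?H i * fps_nth (congr_euler_denom p j) (p * n - i)) =
     (\<Sum>i | i \<le> p * n \<and> p dvd i. fps_nth ?H i * fps_nth (congr_euler_denom p j) (p * n - i))"
  proof (rule sum.mono_neutral_right)
    show "\<forall>i\<in>{..p * n} - {i. i \<le> p * n \<and> p dvd i}.
        fps_nth ?H i * fps_nth (congr_euler_denom p j) (p * n - i) = 0"
      by (auto simp: congr_euler_denom_def dest: dvd_diffD1)
  qed auto
  moreover have "\<dots> = (\<Sum>k\<le>n. fps_nth ?H (p * k) / fact (p * n - p * k + j))"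
    by (subst sum_multiples) (auto simp: congr_euler_denom_def intro!: sum.cong)
  ultimately have "fact (p * n + j) *
      (\<Sum>k\<le>n. fps_nth ?H (p * k) / fact (p * n - p * k + j)) = 0"
    by simp
  moreover have "fact (p * n + j) * (\<Sum>k\<le>n. fps_nth ?H (p * k) / fact (p * n - p * k + j)) =
      (\<Sum>k\<le>n. of_nat ((p * n + j) choose (p * k)) * congr_euler p j (p * k))"
    unfolding sum_distrib_left
  proof (rule sum.cong)
    fix k assume "k \<in> {..n}"
    then have le: "p * k \<le> p * n" by simp
    then have "p * n + j - p * k = p * n - p * k + j" by linarith
    then have "of_nat ((p * n + j) choose (p * k)) =
        (fact (p * n + j) / (fact (p * k) * fact (p * n - p * k + j)) :: rat)"
      using binomial_fact[OF trans_le_add1[OF le], where 'a = rat] by simp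
    then show "fact (p * n + j) * (fps_nth ?H (p * k) / fact (p * n - p * k + j)) =
        of_nat ((p * n + j) choose (p * k)) * congr_euler p j (p * k)"
      by (simp add: congr_euler_def)
  qed simp
  ultimately show ?thesis by simp
qed

context
  fixes j :: nat
  assumes j: "j < p"
begin

text \<open>The system is triangular with diagonal entries prime to \<open>p\<close>, so it can be
  solved for \<open>x\<close> by strong induction. It yields both integrality (\<open>m = 0\<close>)
  and the binomial sums below.\<close>

lemma p_dvd_triangular:
  assumes "\<And>n. p_dvd p m (\<Sum>k\<le>n. of_nat ((p * n + j) choose (p * k)) * x k)"
  shows "p_dvd p m (x n)"
proof (induction n rule: less_induct)
  case (less n)
  have "p_dvd p m ((\<Sum>k\<le>n. of_nat ((p * n + j) choose (p * k)) * x k)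
      - (\<Sum>k<n. of_nat ((p * n + j) choose (p * k)) * x k))"
    by (intro p_dvd_diff p assms p_dvd_sum p_dvd_of_nat_mult_left less) auto
  then have "p_dvd p m (of_nat ((p * n + j) choose (p * n)) * x n)"
    by (simp add: lessThan_Suc_atMost[symmetric])
  then show ?case using not_prime_dvd_binomial[OF j] p_dvd_mult_cancel_left[OF p] by blast
qed

lemma p_integral_congr_euler: "p_integral p (congr_euler p j (p * n))"
proof -
  have "p_dvd p 0 (\<Sum>k\<le>n. of_nat ((p * n + j) choose (p * k)) * congr_euler p j (p * k))" for n
  proof (cases "n = 0")
    case True
    then show ?thesis
      \<comment> \<open>For \<open>n = 0\<close> the sum is the constant coefficient of the inverse
        series, namely \<open>fact j\<close>.\<close>
      using p_integral_of_int[OF p, of "fact j"]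
      by (simp add: p_dvd_0_iff congr_euler_def congr_euler_denom_def)
  next
    case False
    then show ?thesis by (simp add: congr_euler_recurrence p_dvd_zero[OF p])
  qed
  then show ?thesis using p_dvd_triangular[of 0 "\<lambda>n. congr_euler p j (p * n)"] by (simp add: p_dvd_0_iff)
qed

context
  fixes d :: nat and e :: "nat \<Rightarrow> rat"
  assumes odd_p: "odd p" and d_def: "d = (if j = 0 then 1 else 0)"
  defines "e \<equiv> \<lambda>n. congr_euler p j (p * n)"
begin

text \<open>After the binomials are replaced, the recurrence at \<open>n + q\<close> becomes row
  \<open>n\<close> of the triangular system whose unknowns are these sums.\<close>

lemma p_dvd_binomial_sum:
  "p_dvd p (Suc t + d) (\<Sum>l\<le>p ^ t. of_nat (p ^ t choose l) * e (i + l))"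
proof (rule p_dvd_triangular[of _ "\<lambda>i. \<Sum>l\<le>p ^ t. of_nat (p ^ t choose l) * e (i + l)"])
  fix n
  define q where "q = p ^ t"
  have q: "q > 0" using p by (simp add: q_def prime_gt_0_nat)
  let ?S = "\<lambda>k. \<Sum>i\<le>k. ((p * n + j) choose (p * i)) * (q choose (k - i))"
  have "p_dvd p (Suc t + d)
      ((of_nat (((p * n + j + p ^ Suc t) choose (p * k))) - of_nat (?S k)) * e k)" for k
  proof -
    have "int p ^ (Suc t + d) dvd int ((p * n + j + p ^ Suc t) choose (p * k)) - int (?S k)"
      using binomial_add_prime_power_cong[OF odd_p d_def, of n t k]
      unfolding q_def by (simp only: cong_iff_dvd_diff flip: cong_int_iff of_nat_power)
    from p_dvd_mult[OF p p_dvd_of_int[OF p this], of 0 "e k"] show ?thesis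
      using p_integral_congr_euler by (simp add: p_dvd_0_iff e_def)
  qed
  then have "p_dvd p (Suc t + d) (\<Sum>k\<le>n + q.
      (of_nat (((p * n + j + p ^ Suc t) choose (p * k))) - of_nat (?S k)) * e k)"
    by (intro p_dvd_sum p)
  moreover have "(\<Sum>k\<le>n + q. of_nat (((p * n + j + p ^ Suc t) choose (p * k))) * e k) = 0"
    using congr_euler_recurrence[of "n + q" j] q
    by (simp add: e_def q_def algebra_simps)
  ultimately have "p_dvd p (Suc t + d) (- (\<Sum>k\<le>n + q. of_nat (?S k) * e k))"
    by (simp only: left_diff_distrib sum_subtractf diff_0)
  then have "p_dvd p (Suc t + d) (\<Sum>k\<le>n + q. of_nat (?S k) * e k)"
    using p_dvd_uminus[OF p] by fastforce
  \<comment> \<open>Writing \<open>k\<close> as \<open>i + (k - i)\<close> prepares the change of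
    variables \<open>l = k - i\<close>.\<close>
  also have "(\<Sum>k\<le>n + q. of_nat (?S k) * e k) = (\<Sum>k\<le>n + q. \<Sum>i\<le>k.
      of_nat ((p * n + j) choose (p * i)) * (of_nat (q choose (k - i)) * e (i + (k - i))))"
    by (simp add: sum_distrib_right mult.assoc)
  also have "\<dots> = (\<Sum>(i,l) | i + l \<le> n + q.
      of_nat ((p * n + j) choose (p * i)) * (of_nat (q choose l) * e (i + l)))"
    by (rule sum.triangle_reindex_eq[symmetric])
  \<comment> \<open>Outside the rectangle a binomial vanishes: for \<open>i > n\<close> because
    \<open>j < p\<close> forces \<open>p * n + j < p * i\<close>, for \<open>l > q\<close>
    trivially.\<close>
  also have "\<dots> = (\<Sum>(i,l)\<in>{..n} \<times> {..q}.
      of_nat ((p * n + j) choose (p * i)) * (of_nat (q choose l) * e (i + l)))"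
  proof (rule sum.mono_neutral_right)
    show "finite {(i, l). i + l \<le> n + q}"
      by (rule finite_subset[of _ "{..n + q} \<times> {..n + q}"]) auto
    have *: "p * n + j < p * i" if "n < i" for i
    proof -
      have "p * n + j < p * Suc n" using j by simp
      also have "\<dots> \<le> p * i" using that by (intro mult_le_mono2) auto
      finally show "p * n + j < p * i" .
    qed
    show "\<forall>x\<in>{(i, l). i + l \<le> n + q} - {..n} \<times> {..q}. (case x of (i, l) \<Rightarrow>
        of_nat ((p * n + j) choose (p * i)) * (of_nat (q choose l) * e (i + l))) = 0"
      by (auto simp: not_le) (meson * not_le)
  qed auto
  also have "\<dots> = (\<Sum>i\<le>n. of_nat ((p * n + j) choose (p * i)) *
      (\<Sum>l\<le>p ^ t. of_nat (p ^ t choose l) * e (i + l)))"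
    by (simp add: sum.cartesian_product[symmetric] sum_distrib_left q_def)
  finally show "p_dvd p (Suc t + d) \<dots>" .
qed

text \<open>Each shift by \<open>a\<close> changes the sign modulo \<open>p ^ m\<close>.\<close>

lemma p_dvd_iterate:
  assumes "\<And>i. p_dvd p m (e i + e (i + a))"
  shows "p_dvd p m (e (i + a * u) - (-1) ^ u * e i)"
proof (induction u)
  case 0
  then show ?case using p by simp
next
  case (Suc u)
  have "p_dvd p m ((e (i + a * u) + e (i + a * u + a)) - (e (i + a * u) - (-1) ^ u * e i))"
    by (intro p_dvd_diff p assms Suc)
  then show ?case by (simp add: algebra_simps)
qed

lemma p_dvd_congr_euler_add: "p_dvd p (Suc t + d) (e i + e (i + p ^ t))"
proof (induction t arbitrary: i rule: less_induct)
  case (less t)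
  define q where "q = p ^ t"
  have q: "q > 0" "odd q" using p odd_p by (auto simp: q_def prime_gt_0_nat)
  \<comment> \<open>Subtracting \<open>(-1) ^ l * e i\<close> leaves the total unchanged, since the
    alternating binomial sum is 0 for \<open>q > 0\<close>.\<close>
  define f :: "nat \<Rightarrow> rat" where "f l = of_nat (q choose l) * (e (i + l) - (-1) ^ l * e i)" for l
  have f: "p_dvd p (Suc t + d) (f l)" if l: "0 < l" "l < q" for l
  proof -
    obtain s u where su: "l = p ^ s * u" "\<not> p dvd u"
      using prime_power_canonical[OF p l(1)] by (metis mult.commute)
    have "s < t"
    proof (rule ccontr)
      assume "\<not> s < t"
      then have "p ^ t dvd l" unfolding su by (intro dvd_mult2 le_imp_power_dvd) simp
      then show False using l nat_dvd_not_less[of l "p ^ t"] by (simp add: q_def)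
    qed
    have "p_dvd p (t - s) (of_nat (q choose l))"
      unfolding q_def su using \<open>s < t\<close> su by (intro p_dvd_of_nat p power_dvd_binomial) auto
    moreover have "p_dvd p (Suc s + d) (e (i + p ^ s * u) - (-1) ^ u * e i)"
      by (rule p_dvd_iterate) (rule less.IH[OF \<open>s < t\<close>])
    \<comment> \<open>As \<open>p\<close> is odd, \<open>u\<close> and \<open>p ^ s * u\<close> have
      the same parity.\<close>
    moreover have "(-1 :: rat) ^ u = (-1) ^ l"
      unfolding su power_mult using odd_p by simp
    \<comment> \<open>The loss of \<open>s\<close> in the binomial is made up by the induction
      hypothesis at \<open>s\<close>.\<close>
    ultimately have "p_dvd p (t - s + (Suc s + d)) (f l)"
      unfolding f_def by (intro p_dvd_mult p) (simp_all add: su)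
    then show ?thesis using \<open>s < t\<close> by simp
  qed
  have "(\<Sum>l\<le>q. of_nat (q choose l) * (-1) ^ l) = (0 :: rat)"
    using choose_alternating_sum[OF q(1), where 'a = rat] by (simp add: mult.commute)
  then have "(\<Sum>l\<le>q. of_nat (q choose l) * (-1) ^ l * e i) = 0"
    by (simp flip: sum_distrib_right)
  then have "(\<Sum>l\<le>q. f l) = (\<Sum>l\<le>q. of_nat (q choose l) * e (i + l))"
    by (simp add: f_def right_diff_distrib sum_subtractf mult.assoc)
  then have "p_dvd p (Suc t + d) (\<Sum>l\<le>q. f l)"
    using p_dvd_binomial_sum[of t i] by (simp add: q_def)
  then have "p_dvd p (Suc t + d) ((\<Sum>l\<le>q. f l) - (\<Sum>l\<in>{0<..<q}. f l))"
    by (rule p_dvd_diff[OF p _ p_dvd_sum[OF p f]]) auto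
  also have "{..q} = insert 0 (insert q {0<..<q})" using q by auto
  then have "(\<Sum>l\<le>q. f l) - (\<Sum>l\<in>{0<..<q}. f l) = f q + f 0" using q by simp
  \<comment> \<open>Here \<open>f 0 = 0\<close>, and the sign in \<open>f q\<close> is negative
    because \<open>q\<close> is odd.\<close>
  also have "\<dots> = e i + e (i + p ^ t)"
    using q by (simp add: f_def q_def)
  finally show ?case .
qed

end

end

end

theorem theorem1p1:
  fixes p r j n :: nat
  assumes "prime p" and "odd p" and "r > 0" and "j \<le> p - 1"
  shows "p_integral p (congr_euler p j (p * n)) \<and>
         p_integral p (congr_euler p j (p * n + p ^ r)) \<and>
         p_cong p (r + (if j = 0 then 1 else 0))
           (congr_euler p j (p * n) + congr_euler p j (p * n + p ^ r)) 0"
proof -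
  note p = \<open>prime p\<close>
  have j: "j < p" using \<open>j \<le> p - 1\<close> prime_gt_0_nat[OF p] by linarith
  obtain t where t: "r = Suc t" using \<open>r > 0\<close> gr0_implies_Suc by blast
  \<comment> \<open>One factor \<open>p\<close> of \<open>p ^ r\<close> goes into the index of
    \<open>e\<close>, hence the shift by \<open>p ^ t\<close> with \<open>r = Suc t\<close>.\<close>
  have idx: "p * n + p ^ r = p * (n + p ^ t)" by (simp add: t algebra_simps)
  have int: "p_integral p (congr_euler p j (p * m))" for m
    by (rule p_integral_congr_euler[OF p j])
  have "p_dvd p (Suc t + (if j = 0 then 1 else 0))
      (congr_euler p j (p * n) + congr_euler p j (p * (n + p ^ t)))"
    by (rule p_dvd_congr_euler_add[OF p j \<open>odd p\<close> refl])
  then show ?thesis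
    unfolding idx p_cong_def
    using int p_integral_add[OF p int int] p_integral_of_int[OF p, of 0]
    by (simp add: p_dvd_def t)
qed

end
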